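(* The Cesàro summation method fulfills none of the three properties associativity, commutativity and dilution. That is, Cesàro summation does not have the associativity property, does not have the commutativity property, and does not have the dilution property.
   Context: For a real sequence $(a_0,a_1,a_2,\dots)$ put $S_k=\sum_{j=0}^{k}a_j$ and $Z_n=\frac1n\sum_{k=0}^{n-1}S_k$ for $n\ge 1$. The Cesàro sum of the series $\sum_n a_n$ is $\lim_{n\to\infty}Z_n$, when this limit exists (as a finite or infinite value). A summation method has the - associativity property if, whenever a series with terms $(a_n)_{n\ge 0}$ has a sum by the method, every series obtained from it by replacing, for some or all nonnegative integers $k$, the two consecutive terms $a_{2k},a_{2k+1}$ by the single term $a_{2k}+a_{2k+1}$ has the same sum by the method; - commutativity property if, whenever a series with terms $(a_n)_{n\ge 0}$ has a sum by the method, every series obtained from it by interchanging $a_{2k}$ and $a_{2k+1}$ for some or all nonnegative integers $k$ has the same sum by the method; - dilution property if, whenever a series with terms $(a_n)_{n\ge 0}$ has a sum by the method, every series obtained from it by inserting a single zero between $a_n$ and $a_{n+1}$ for some or all nonnegative integers $n$ has the same sum by the method. *)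

theory Defs
  imports "HOL-Analysis.Analysis"
begin

text \<open>A summation method is a relation: \<open>M a s\<close> means that the series with terms
  \<open>a 0, a 1, \<dots>\<close> has the (finite or infinite) sum \<open>s\<close> by \<open>M\<close>.\<close>

type_synonym summation_method = "(nat \<Rightarrow> real) \<Rightarrow> ereal \<Rightarrow> bool"

definition partial_sum :: "(nat \<Rightarrow> real) \<Rightarrow> nat \<Rightarrow> real" where
  "partial_sum a k = (\<Sum>j\<le>k. a j)"

text \<open>The mean is only meaningful for \<open>n \<ge> 1\<close>; the value \<open>0\<close> at \<open>n = 0\<close> does not affect the limit.\<close>

definition cesaro_mean :: "(nat \<Rightarrow> real) \<Rightarrow> nat \<Rightarrow> real" where
  "cesaro_mean a n = (1 / real n) * (\<Sum>k<n. partial_sum a k)"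

definition cesaro_sums :: summation_method where
  "cesaro_sums a s \<longleftrightarrow> (\<lambda>n. ereal (cesaro_mean a n)) \<longlonglongrightarrow> s"

text \<open>For \<open>k \<in> K\<close> the terms \<open>2k\<close> and \<open>2k+1\<close> are merged. A term of the new series is identified
  by the index at which it starts in the old one, so exactly the indices \<open>2k+1\<close> with
  \<open>k \<in> K\<close> are dropped, and the remaining ones are numbered consecutively by \<^const>\<open>enumerate\<close>.\<close>

definition group_starts :: "nat set \<Rightarrow> nat set" where
  "group_starts K = - {2 * k + 1 | k. k \<in> K}"

definition group_pairs :: "nat set \<Rightarrow> (nat \<Rightarrow> real) \<Rightarrow> nat \<Rightarrow> real" where
  "group_pairs K a m =
     (let i = enumerate (group_starts K) m
      in if even i \<and> i div 2 \<in> K then a i + a (i + 1) else a i)"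

definition swap_pairs :: "nat set \<Rightarrow> (nat \<Rightarrow> real) \<Rightarrow> nat \<Rightarrow> real" where
  "swap_pairs K a i =
     (if i div 2 \<in> K then (if even i then a (i + 1) else a (i - 1)) else a i)"

text \<open>A zero is inserted right after \<open>a n\<close> for each \<open>n \<in> N\<close>, so \<open>a n\<close> is shifted to the right
  by the number of zeros inserted before it; the places not hit by this shift are the zeros.\<close>

definition diluted_index :: "nat set \<Rightarrow> nat \<Rightarrow> nat" where
  "diluted_index N n = n + card {j \<in> N. j < n}"

definition dilute :: "nat set \<Rightarrow> (nat \<Rightarrow> real) \<Rightarrow> nat \<Rightarrow> real" where
  "dilute N a m =
     (if m \<in> range (diluted_index N) then a (inv (diluted_index N) m) else 0)"

definition associativity_property :: "summation_method \<Rightarrow> bool" where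
  "associativity_property M \<longleftrightarrow> (\<forall>a s K. M a s \<longrightarrow> M (group_pairs K a) s)"

definition commutativity_property :: "summation_method \<Rightarrow> bool" where
  "commutativity_property M \<longleftrightarrow> (\<forall>a s K. M a s \<longrightarrow> M (swap_pairs K a) s)"

definition dilution_property :: "summation_method \<Rightarrow> bool" where
  "dilution_property M \<longleftrightarrow> (\<forall>a s N. M a s \<longrightarrow> M (dilute N a) s)"

end

theory Submission
  imports Defs
begin

text \<open>A series whose terms are periodic and add up to zero over a period has periodic partial sums,
  so its Cesaro sum is the average of the partial sums over one period. Grandi's series
  \<open>1 - 1 + 1 - 1 + \<dots>\<close> thus has sum \<open>1/2\<close>. Merging all pairs turns it into the zero series
  (sum \<open>0\<close>), swapping all pairs into its negative (sum \<open>-1/2\<close>), and inserting a zero after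
  every positive term into \<open>1 + 0 - 1 + 1 + 0 - 1 + \<dots>\<close> (sum \<open>2/3\<close>).\<close>

definition has_period :: "nat \<Rightarrow> (nat \<Rightarrow> 'a) \<Rightarrow> bool" where
  "has_period p f \<longleftrightarrow> (\<forall>n. f (n + p) = f n)"

lemma has_periodD: "has_period p f \<Longrightarrow> f (n + p) = f n"
  by (simp add: has_period_def)

lemma has_period_eq_mod:
  assumes "has_period p f"
  shows "f n = f (n mod p)"
proof -
  have "f (m + q * p) = f m" for m q
  proof (induction q)
    case (Suc q)
    then show ?case
      using has_periodD[OF assms, of "m + q * p"] by (simp add: ac_simps)
  qed simp
  from this[of "n mod p" "n div p"] show ?thesis by simp
qed

lemma has_period_imp_finite_range:
  assumes "p > 0" and "has_period p f"
  shows "finite (range f)"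
proof (rule finite_subset)
  show "range f \<subseteq> f ` {..<p}"
  proof (rule image_subsetI)
    fix n
    have "n mod p \<in> {..<p}" using \<open>p > 0\<close> by simp
    then show "f n \<in> f ` {..<p}"
      using has_period_eq_mod[OF \<open>has_period p f\<close>, of n] by blast
  qed
qed simp

lemma has_period_sum_lessThan:
  fixes f :: "nat \<Rightarrow> 'a::comm_monoid_add"
  assumes "has_period p f" and "(\<Sum>k<p. f k) = 0"
  shows "has_period p (\<lambda>n. \<Sum>k<n. f k)"
  unfolding has_period_def
proof
  fix n
  show "(\<Sum>k<n + p. f k) = (\<Sum>k<n. f k)"
    using assms by (induction n) (simp_all add: has_periodD)
qed

lemma has_period_partial_sum:
  assumes "has_period p a" and "(\<Sum>k<p. a k) = 0"
  shows "has_period p (partial_sum a)"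
  unfolding has_period_def
proof
  fix n
  show "partial_sum a (n + p) = partial_sum a n"
    using has_periodD[OF has_period_sum_lessThan[OF assms], of "Suc n"]
    by (simp add: partial_sum_def lessThan_Suc_atMost)
qed

lemma tendsto_mean_has_period:
  fixes f :: "nat \<Rightarrow> 'a::real_normed_vector"
  assumes "p > 0" and "has_period p f"
  shows "(\<lambda>n. (\<Sum>k<n. f k) /\<^sub>R real n) \<longlonglongrightarrow> (\<Sum>k<p. f k) /\<^sub>R real p"
proof -
  define mean where "mean = (\<Sum>k<p. f k) /\<^sub>R real p"
  define deviation where "deviation n = (\<Sum>k<n. f k - mean)" for n
  have "has_period p (\<lambda>k. f k - mean)"
    using assms by (simp add: has_period_def)
  moreover have "(\<Sum>k<p. f k - mean) = 0"
    using \<open>p > 0\<close> by (simp add: sum_subtractf mean_def sum_constant_scaleR)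
  ultimately have "has_period p deviation"
    unfolding deviation_def by (rule has_period_sum_lessThan)
  with \<open>p > 0\<close> have "bounded (range deviation)"
    by (intro finite_imp_bounded has_period_imp_finite_range)
  then obtain B where "\<And>n. norm (deviation n) \<le> B"
    unfolding bounded_iff by blast
  then have "(\<lambda>n. deviation n /\<^sub>R real n) \<longlonglongrightarrow> 0"
    by (intro lim_null_scaleR_bounded[OF lim_inverse_n, where B = B]) simp
  then have "(\<lambda>n. deviation n /\<^sub>R real n + mean) \<longlonglongrightarrow> mean"
    by (auto intro: tendsto_add_zero tendsto_eq_intros)
  moreover have "\<forall>\<^sub>F n in sequentially. deviation n /\<^sub>R real n + mean = (\<Sum>k<n. f k) /\<^sub>R real n"
    using eventually_gt_at_top[of 0]
    by eventually_elim
      (simp add: deviation_def sum_subtractf sum_constant_scaleR scaleR_diff_right)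
  ultimately show ?thesis
    unfolding mean_def by (rule Lim_transform_eventually)
qed

lemma cesaro_sums_has_period:
  assumes "p > 0" and "has_period p a" and "(\<Sum>k<p. a k) = 0"
  shows "cesaro_sums a (cesaro_mean a p)"
  using tendsto_mean_has_period[OF \<open>p > 0\<close> has_period_partial_sum[OF assms(2,3)]]
  by (simp add: cesaro_sums_def cesaro_mean_def inverse_eq_divide)

lemma cesaro_sums_unique: "cesaro_sums a s \<Longrightarrow> cesaro_sums a t \<Longrightarrow> s = t"
  unfolding cesaro_sums_def by (rule LIMSEQ_unique)

lemma enumerate_range_strict_mono:
  fixes f :: "nat \<Rightarrow> 'a::wellorder"
  assumes "strict_mono f"
  shows "enumerate (range f) n = f n"
proof (induction n)
  case 0
  have "(LEAST x. x \<in> range f) = f 0"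
    using assms by (intro Least_equality) (auto simp: strict_mono_less_eq)
  then show ?case by (simp add: enumerate_0)
next
  case (Suc n)
  have "infinite (range f)"
    using assms by (simp add: range_inj_infinite strict_mono_imp_inj_on)
  then have "enumerate (range f) (Suc n) = (LEAST x. x \<in> range f \<and> f n < x)"
    by (simp add: enumerate_Suc'' Suc.IH)
  also have "\<dots> = f (Suc n)"
    using assms by (intro Least_equality) (auto simp: strict_mono_less strict_mono_less_eq)
  finally show ?case .
qed

lemma group_starts_UNIV: "group_starts UNIV = range ((*) 2)"
proof (rule set_eqI)
  fix i
  have "i \<in> group_starts UNIV \<longleftrightarrow> even i"
    unfolding group_starts_def by simp presburger
  then show "i \<in> group_starts UNIV \<longleftrightarrow> i \<in> range ((*) 2)"
    by (auto elim: evenE)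
qed

lemma group_pairs_UNIV: "group_pairs UNIV a m = a (2 * m) + a (2 * m + 1)"
proof -
  have "enumerate (group_starts UNIV) m = 2 * m"
    unfolding group_starts_UNIV
    by (rule enumerate_range_strict_mono) (simp add: strict_mono_Suc_iff)
  then show ?thesis by (simp add: group_pairs_def Let_def)
qed

lemma swap_pairs_UNIV: "swap_pairs UNIV a i = (if even i then a (i + 1) else a (i - 1))"
  by (simp add: swap_pairs_def)

lemma diluted_index_0: "diluted_index N 0 = 0"
  by (simp add: diluted_index_def)

lemma diluted_index_Suc:
  "diluted_index N (Suc n) = diluted_index N n + (if n \<in> N then 2 else 1)"
proof -
  have "{j \<in> N. j < Suc n} = (if n \<in> N then insert n {j \<in> N. j < n} else {j \<in> N. j < n})"
    by (auto simp: less_Suc_eq)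
  then show ?thesis by (simp add: diluted_index_def)
qed

lemma strict_mono_diluted_index: "strict_mono (diluted_index N)"
  by (simp add: strict_mono_Suc_iff diluted_index_Suc)

lemma dilute_diluted_index: "dilute N a (diluted_index N n) = a n"
  by (simp add: dilute_def strict_mono_diluted_index strict_mono_imp_inj_on)

lemma dilute_Suc_diluted_index:
  assumes "n \<in> N"
  shows "dilute N a (Suc (diluted_index N n)) = 0"
proof -
  have "diluted_index N k \<noteq> Suc (diluted_index N n)" for k
  proof (cases "k \<le> n")
    case True
    then have "diluted_index N k \<le> diluted_index N n"
      by (simp add: strict_mono_less_eq[OF strict_mono_diluted_index])
    then show ?thesis by simp
  next
    case False
    then have "diluted_index N (Suc n) \<le> diluted_index N k"
      by (simp add: strict_mono_less_eq[OF strict_mono_diluted_index])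
    with assms show ?thesis by (simp add: diluted_index_Suc)
  qed
  then have "Suc (diluted_index N n) \<notin> range (diluted_index N)" by (metis rangeE)
  then show ?thesis by (simp add: dilute_def)
qed

lemma diluted_index_evens: "diluted_index {j. even j} (2 * k) = 3 * k"
  by (induction k) (simp_all add: diluted_index_0 diluted_index_Suc)

lemma dilute_evens:
  shows "dilute {j. even j} a (3 * k) = a (2 * k)"
    and "dilute {j. even j} a (3 * k + 1) = 0"
    and "dilute {j. even j} a (3 * k + 2) = a (2 * k + 1)"
  using dilute_diluted_index[of "{j. even j}" a "2 * k"]
    dilute_Suc_diluted_index[of "2 * k" "{j. even j}" a]
    dilute_diluted_index[of "{j. even j}" a "2 * k + 1"]
  by (simp_all add: diluted_index_evens diluted_index_Suc)

lemma has_period_dilute_evens: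
  assumes "has_period 2 a"
  shows "has_period 3 (dilute {j. even j} a)"
  unfolding has_period_def
proof
  fix m :: nat
  have "m = 3 * (m div 3) \<or> m = 3 * (m div 3) + 1 \<or> m = 3 * (m div 3) + 2"
    by presburger
  then obtain k where "m = 3 * k \<or> m = 3 * k + 1 \<or> m = 3 * k + 2" ..
  then show "dilute {j. even j} a (m + 3) = dilute {j. even j} a m"
    using dilute_evens[of a k] dilute_evens[of a "Suc k"]
      has_periodD[OF assms, of "2 * k"] has_periodD[OF assms, of "2 * k + 1"]
    by (auto simp: add.commute)
qed

definition grandi :: "nat \<Rightarrow> real" where
  "grandi n = (- 1) ^ n"

lemma has_period_grandi: "has_period 2 grandi"
  by (simp add: has_period_def grandi_def)

lemma cesaro_sums_grandi: "cesaro_sums grandi (ereal (1 / 2))"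
  using cesaro_sums_has_period[OF _ has_period_grandi]
  by (simp add: cesaro_mean_def partial_sum_def grandi_def numeral_2_eq_2)

lemma cesaro_sums_group_pairs_UNIV_grandi: "cesaro_sums (group_pairs UNIV grandi) 0"
proof -
  have "group_pairs UNIV grandi = (\<lambda>_. 0)"
    by (simp add: fun_eq_iff group_pairs_UNIV grandi_def)
  then show ?thesis
    by (simp add: cesaro_sums_def cesaro_mean_def partial_sum_def zero_ereal_def)
qed

lemma cesaro_sums_swap_pairs_UNIV_grandi: "cesaro_sums (swap_pairs UNIV grandi) (ereal (- 1 / 2))"
proof -
  have "swap_pairs UNIV grandi = (\<lambda>n. - grandi n)"
    by (simp add: fun_eq_iff swap_pairs_UNIV grandi_def)
  moreover have "has_period 2 (\<lambda>n. - grandi n)"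
    using has_period_grandi by (simp add: has_period_def)
  ultimately show ?thesis
    using cesaro_sums_has_period[of 2 "\<lambda>n. - grandi n"]
    by (simp add: cesaro_mean_def partial_sum_def grandi_def numeral_2_eq_2)
qed

lemma cesaro_sums_dilute_evens_grandi: "cesaro_sums (dilute {j. even j} grandi) (ereal (2 / 3))"
proof -
  have "dilute {j. even j} grandi 0 = 1" "dilute {j. even j} grandi 1 = 0"
    "dilute {j. even j} grandi 2 = - 1"
    using dilute_evens[of grandi 0] by (simp_all add: grandi_def numeral_2_eq_2)
  then show ?thesis
    using cesaro_sums_has_period[OF _ has_period_dilute_evens[OF has_period_grandi]]
    by (simp add: cesaro_mean_def partial_sum_def numeral_2_eq_2 numeral_3_eq_3)
qed

theorem lemma1:
  "\<not> associativity_property cesaro_sums \<and>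
   \<not> commutativity_property cesaro_sums \<and>
   \<not> dilution_property cesaro_sums"
proof (intro conjI notI)
  assume "associativity_property cesaro_sums"
  with cesaro_sums_grandi have "cesaro_sums (group_pairs UNIV grandi) (ereal (1 / 2))"
    unfolding associativity_property_def by blast
  from cesaro_sums_unique[OF this cesaro_sums_group_pairs_UNIV_grandi] show False by simp
next
  assume "commutativity_property cesaro_sums"
  with cesaro_sums_grandi have "cesaro_sums (swap_pairs UNIV grandi) (ereal (1 / 2))"
    unfolding commutativity_property_def by blast
  from cesaro_sums_unique[OF this cesaro_sums_swap_pairs_UNIV_grandi] show False by simp
next
  assume "dilution_property cesaro_sums"
  with cesaro_sums_grandi have "cesaro_sums (dilute {j. even j} grandi) (ereal (1 / 2))"
    unfolding dilution_property_def by blast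
  from cesaro_sums_unique[OF this cesaro_sums_dilute_evens_grandi] show False by simp
qed

end
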